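(* Let $a,z\in\mathbb{C}$ and let $n\ge 1$ be an integer. Then $$(az)_n=\sum_{l=1}^n b_{l,n;a}\,(z)_l .$$
   Context: For $z\in\mathbb{C}$ and an integer $n\ge 1$, $(z)_n=z(z-1)\cdots(z-n+1)$ is the falling factorial, with $(z)_0=1$. For $a\in\mathbb{C}$, the triangular array $(b_{j,n;a})_{n\ge 1,\,1\le j\le n}$ is defined by $b_{1,n;a}=(a)_n$, $b_{n,n;a}=a^n$ for $n\ge 1$, and the recurrence $$b_{j,n+1;a}=(aj-n)\,b_{j,n;a}+a\,b_{j-1,n;a},\qquad 2\le j\le n.$$ *)

theory Defs
  imports Complex_Main
begin

definition falling_fact :: "complex \<Rightarrow> nat \<Rightarrow> complex" where
  "falling_fact z n = (\<Prod>i<n. z - of_nat i)"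

text \<open>
  \<open>b_coeff a j n\<close> is the entry $b_{j,n;a}$ of the triangular array.  It is meaningful only for
  \<open>1 \<le> j \<le> n\<close>; outside this range it has the dummy value \<open>0\<close>, which the recurrence
  never reads. The overlap of the two boundary conditions at \<open>j = n = 1\<close> is harmless, as both
  give \<open>a\<close>. The lemmas below are the defining conditions of the array.
\<close>

fun b_coeff :: "complex \<Rightarrow> nat \<Rightarrow> nat \<Rightarrow> complex" where
  "b_coeff a j 0 = 0"
| "b_coeff a j (Suc n) =
     (if j = 1 then falling_fact a (Suc n)
      else if j = Suc n then a ^ Suc n
      else if 2 \<le> j \<and> j \<le> n then
        (a * of_nat j - of_nat n) * b_coeff a j n + a * b_coeff a (j - 1) n
      else 0)"

lemma b_coeff_first: "n \<ge> 1 \<Longrightarrow> b_coeff a 1 n = falling_fact a n"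
  by (cases n) auto

lemma b_coeff_diag: "n \<ge> 1 \<Longrightarrow> b_coeff a n n = a ^ n"
  by (cases n) (auto simp: falling_fact_def)

lemma b_coeff_rec:
  "2 \<le> j \<Longrightarrow> j \<le> n \<Longrightarrow>
     b_coeff a j (n + 1) = (a * of_nat j - of_nat n) * b_coeff a j n + a * b_coeff a (j - 1) n"
  by simp

end

theory Submission
  imports Defs
begin

text \<open>
  The proof is an induction on \<open>n\<close>.  Passing from \<open>n\<close> to \<open>n + 1\<close> multiplies the left-hand side by
  \<open>a z - n\<close>.  On the basis of falling factorials this multiplication is bidiagonal: writing
  \[ a z - n = a\,(z - l) + (a l - n) \]
  and using \<open>(z)\<^sub>l (z - l) = (z)\<^sub>l\<^sub>+\<^sub>1\<close>, it sends \<open>(z)\<^sub>l\<close> to \<open>a (z)\<^sub>l\<^sub>+\<^sub>1 + (a l - n) (z)\<^sub>l\<close>.  Collecting the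
  coefficient of \<open>(z)\<^sub>l\<close> gives the recurrence that defines the array, provided that
  the recurrence also holds on the boundary \<open>l = 1\<close> and \<open>l = n + 1\<close>; this is \<open>b_coeff_Suc\<close> below,
  where entries outside the triangle count as \<open>0\<close>.
\<close>

lemma falling_fact_Suc: "falling_fact z (Suc n) = (z - of_nat n) * falling_fact z n"
  by (simp add: falling_fact_def)

lemma b_coeff_0_left: "b_coeff a 0 n = 0"
  by (cases n) auto

lemma b_coeff_above_diag: "n < j \<Longrightarrow> b_coeff a j n = 0"
  by (cases n) auto

text \<open>
  With zero entries outside the triangle the two boundary conditions become instances of the
  recurrence: in the first column it reads \<open>(a)\<^sub>n\<^sub>+\<^sub>1 = (a - n) (a)\<^sub>n\<close>, and on the diagonal
  \<open>a\<^sup>n\<^sup>+\<^sup>1 = a \<sqdot> a\<^sup>n\<close>.  It starts at \<open>n = 1\<close>, since row \<open>0\<close> is zero and row \<open>1\<close> is not.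
\<close>

lemma b_coeff_Suc:
  assumes "n \<ge> 1"
  shows "b_coeff a (Suc j) (Suc n) =
           (a * of_nat (Suc j) - of_nat n) * b_coeff a (Suc j) n + a * b_coeff a j n"
proof -
  consider "j = 0" | "j = n" | "1 \<le> j" "j < n" | "n < j"
    by linarith
  then show ?thesis
  proof cases
    case 1
    then show ?thesis
      using b_coeff_first[of n a] b_coeff_first[of "Suc n" a] assms
      by (simp add: falling_fact_Suc b_coeff_0_left del: b_coeff.simps)
  next
    case 2
    then show ?thesis
      using b_coeff_diag[of n a] b_coeff_diag[of "Suc n" a] assms
      by (simp add: b_coeff_above_diag del: b_coeff.simps)
  next
    case 3
    then show ?thesis
      using b_coeff_rec[of "Suc j" n a] by (simp del: b_coeff.simps)
  next
    case 4
    then show ?thesis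
      by (simp add: b_coeff_above_diag del: b_coeff.simps)
  qed
qed

theorem theorem1p6:
  fixes a z :: complex and n :: nat
  assumes "n \<ge> 1"
  shows "falling_fact (a * z) n = (\<Sum>l=1..n. b_coeff a l n * falling_fact z l)"
  using assms
proof (induction n rule: dec_induct)
  case base
  show ?case
    by (simp add: falling_fact_def)
next
  case (step n)
  let ?b = "\<lambda>l. b_coeff a l n" and ?f = "falling_fact z"
  have "falling_fact (a * z) (Suc n) = (\<Sum>l=1..n. (a * z - of_nat n) * (?b l * ?f l))"
    by (simp add: falling_fact_Suc step.IH sum_distrib_left)
  also have "\<dots> = (\<Sum>l=1..n. (a * of_nat l - of_nat n) * ?b l * ?f l + a * ?b l * ?f (Suc l))"
    by (intro sum.cong refl) (simp add: falling_fact_Suc algebra_simps)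
  also have "\<dots> = (\<Sum>l=1..n. (a * of_nat l - of_nat n) * ?b l * ?f l)
                + (\<Sum>l=1..n. a * ?b l * ?f (Suc l))"
    by (simp only: sum.distrib)
  \<comment> \<open>Both sums are brought to the range \<open>{0..n}\<close> with \<open>(z)\<^sub>l\<^sub>+\<^sub>1\<close> as basis vector:
      the first gains the zero entry at \<open>l = n + 1\<close>, the second the zero entry in column \<open>0\<close>.\<close>
  also have "(\<Sum>l=1..n. (a * of_nat l - of_nat n) * ?b l * ?f l)
           = (\<Sum>l=1..Suc n. (a * of_nat l - of_nat n) * ?b l * ?f l)"
    by (simp add: b_coeff_above_diag)
  also have "\<dots> = (\<Sum>l=0..n. (a * of_nat (Suc l) - of_nat n) * ?b (Suc l) * ?f (Suc l))"
    by (simp only: One_nat_def sum.shift_bounds_cl_Suc_ivl)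
  also have "(\<Sum>l=1..n. a * ?b l * ?f (Suc l)) = (\<Sum>l=0..n. a * ?b l * ?f (Suc l))"
    by (simp add: sum.atLeast_Suc_atMost[of 0 n] b_coeff_0_left)
  also have "(\<Sum>l=0..n. (a * of_nat (Suc l) - of_nat n) * ?b (Suc l) * ?f (Suc l)) + \<dots>
           = (\<Sum>l=0..n. b_coeff a (Suc l) (Suc n) * ?f (Suc l))"
    by (simp only: b_coeff_Suc[OF step.hyps(1)] sum.distrib[symmetric] distrib_right)
  also have "\<dots> = (\<Sum>l=1..Suc n. b_coeff a l (Suc n) * ?f l)"
    by (simp only: One_nat_def sum.shift_bounds_cl_Suc_ivl)
  finally show ?case .
qed

end
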